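(* Let $G$ be a $\overline{C}$-group, with a fixed $\overline{C}$-type presentation $\Pi$. Then the homomorphism $$\pi\times\mathrm{Ab}_{\mathrm{f}}\colon G^{\mathcal{D}}\to G\times\mathbb{Z}^{\mathfrak{C}_{\mathrm{fg}}(G)}$$ is injective.
   Context: A $\overline{C}$-group is a group $G$ admitting a presentation $\Pi$ (a $\overline{C}$-type presentation), with some generator set $\Gamma$, in which every relation is either a conjugation relation $b^{-1}ab=c$ with $a,b,c\in\Gamma$, or a power relation $a^k=1$ with $a\in\Gamma$, $k\ge 2$; there is at most one power relation per conjugacy class of $G$ (i.e., for each conjugacy class $\mathcal{O}$ of $G$, at most one power relation $a^k=1$ has $a\in\mathcal{O}$). $\mathfrak{C}_{\mathrm{g}}(G)$ is the set of conjugacy classes of $G$ containing some generator from $\Gamma$; it is the disjoint union of $\mathfrak{C}_{\mathrm{fg}}(G)$ (classes whose elements have finite order) and $\mathfrak{C}_{\mathrm{ig}}(G)$ (classes whose elements have infinite order). For a set $X$, $\mathbb{Z}^X$ is the free abelian group with basis $(c_x)_{x\in X}$ (direct sum). The Dehn quandle $\Gamma^G$ is the union of the $G$-conjugacy classes of the elements of $\Gamma$, with $a\triangleleft b=b^{-1}ab$, and $G^{\mathcal{D}}=\langle e_a,\ a\in\Gamma^G\mid e_ae_b=e_be_{a\triangleleft b},\ a,b\in\Gamma^G\rangle$. The map $\pi\colon G^{\mathcal{D}}\to G$ is $e_a\mapsto a$. The map $\mathrm{Ab}_{\mathrm{f}}\colon G^{\mathcal{D}}\to\mathbb{Z}^{\mathfrak{C}_{\mathrm{fg}}(G)}$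 is the composition of the abelianisation map $G^{\mathcal{D}}\to\mathbb{Z}^{\mathfrak{C}_{\mathrm{g}}(G)}=\mathbb{Z}^{\mathfrak{C}_{\mathrm{fg}}(G)}\oplus\mathbb{Z}^{\mathfrak{C}_{\mathrm{ig}}(G)}$ (sending $e_a$ to $c_{\mathcal{O}}$ for $a\in\mathcal{O}$) with the projection onto $\mathbb{Z}^{\mathfrak{C}_{\mathrm{fg}}(G)}$. *)

theory Defs
  imports "HOL-Algebra.Free_Abelian_Groups" "HOL-Algebra.Multiplicative_Group"
begin

text \<open>The letter \<open>(x, True)\<close> stands for the generator \<open>x\<close>, the letter \<open>(x, False)\<close> for its formal
  inverse. A relation \<open>u = v\<close> is the pair of words \<open>(u, v)\<close>.\<close>

type_synonym 'x word = "('x \<times> bool) list"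

definition words :: "'x set \<Rightarrow> 'x word set" where
  "words X = lists (X \<times> UNIV)"

inductive word_cong :: "'x set \<Rightarrow> ('x word \<times> 'x word) set \<Rightarrow> 'x word \<Rightarrow> 'x word \<Rightarrow> bool"
  for X :: "'x set" and R :: "('x word \<times> 'x word) set" where
  refl: "w \<in> words X \<Longrightarrow> word_cong X R w w"
| sym: "word_cong X R u v \<Longrightarrow> word_cong X R v u"
| trans: "word_cong X R u v \<Longrightarrow> word_cong X R v w \<Longrightarrow> word_cong X R u w"
| app: "word_cong X R u v \<Longrightarrow> word_cong X R u' v' \<Longrightarrow> word_cong X R (u @ u') (v @ v')"
| cancel: "x \<in> X \<Longrightarrow> word_cong X R [(x, b), (x, \<not> b)] []"
| rel: "(u, v) \<in> R \<Longrightarrow> u \<in> words X \<Longrightarrow> v \<in> words X \<Longrightarrow> word_cong X R u v"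

definition word_class :: "'x set \<Rightarrow> ('x word \<times> 'x word) set \<Rightarrow> 'x word \<Rightarrow> 'x word set" where
  "word_class X R w = {v. word_cong X R w v}"

definition presented_group ::
    "'x set \<Rightarrow> ('x word \<times> 'x word) set \<Rightarrow> 'x word set monoid" where
  "presented_group X R =
     \<lparr>carrier = word_class X R ` words X,
      monoid.mult = (\<lambda>A B. \<Union>u\<in>A. \<Union>v\<in>B. word_class X R (u @ v)),
      one = word_class X R []\<rparr>"

definition word_eval :: "('g, 'm) monoid_scheme \<Rightarrow> ('x \<Rightarrow> 'g) \<Rightarrow> 'x word \<Rightarrow> 'g" where
  "word_eval H f w =
     foldr (\<lambda>(x, b) h. (if b then f x else inv\<^bsub>H\<^esub> f x) \<otimes>\<^bsub>H\<^esub> h) w \<one>\<^bsub>H\<^esub>"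

text \<open>The homomorphism \<open>presented_group X R \<rightarrow> H\<close> extending \<open>f\<close> on generators; it is only meaningful if \<open>f\<close>
  respects the relations, since otherwise \<open>word_eval H f\<close> is not constant on classes.\<close>

definition presented_lift :: "('g, 'm) monoid_scheme \<Rightarrow> ('x \<Rightarrow> 'g) \<Rightarrow> 'x word set \<Rightarrow> 'g" where
  "presented_lift H f A = the_elem (word_eval H f ` A)"

text \<open>Generators are formal symbols, interpreted in \<open>G\<close> by \<open>\<gamma>\<close>; distinct symbols are allowed to have
  the same value in \<open>G\<close>.\<close>

definition is_presentation ::
    "('g, 'm) monoid_scheme \<Rightarrow> 'x set \<Rightarrow> ('x \<Rightarrow> 'g) \<Rightarrow> ('x word \<times> 'x word) set \<Rightarrow> bool" where
  "is_presentation G X \<gamma> R \<longleftrightarrow>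
     \<gamma> \<in> X \<rightarrow> carrier G \<and>
     R \<subseteq> words X \<times> words X \<and>
     (\<forall>(u, v)\<in>R. word_eval G \<gamma> u = word_eval G \<gamma> v) \<and>
     presented_lift G \<gamma> \<in> iso (presented_group X R) G"

definition conj_op :: "('g, 'm) monoid_scheme \<Rightarrow> 'g \<Rightarrow> 'g \<Rightarrow> 'g" where
  "conj_op G a b = inv\<^bsub>G\<^esub> b \<otimes>\<^bsub>G\<^esub> a \<otimes>\<^bsub>G\<^esub> b"

definition conj_class :: "('g, 'm) monoid_scheme \<Rightarrow> 'g \<Rightarrow> 'g set" where
  "conj_class G a = conj_op G a ` carrier G"

definition conj_classes :: "('g, 'm) monoid_scheme \<Rightarrow> 'g set set" where
  "conj_classes G = conj_class G ` carrier G"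

definition conj_rel :: "'x \<Rightarrow> 'x \<Rightarrow> 'x \<Rightarrow> 'x word \<times> 'x word" where
  "conj_rel a b c = ([(b, False), (a, True), (b, True)], [(c, True)])"

definition power_rel :: "'x \<Rightarrow> nat \<Rightarrow> 'x word \<times> 'x word" where
  "power_rel a k = (replicate k (a, True), [])"

definition Cbar_presentation ::
    "('g, 'm) monoid_scheme \<Rightarrow> 'x set \<Rightarrow> ('x \<Rightarrow> 'g) \<Rightarrow> ('x word \<times> 'x word) set \<Rightarrow> bool" where
  "Cbar_presentation G X \<gamma> R \<longleftrightarrow>
     is_presentation G X \<gamma> R \<and>
     (\<forall>r\<in>R. (\<exists>a\<in>X. \<exists>b\<in>X. \<exists>c\<in>X. r = conj_rel a b c) \<or> (\<exists>a\<in>X. \<exists>k\<ge>2. r = power_rel a k)) \<and>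
     (\<forall>\<O>\<in>conj_classes G. \<exists>\<^sub>\<le>\<^sub>1r. r \<in> R \<and> (\<exists>a\<in>X. \<exists>k\<ge>2. r = power_rel a k \<and> \<gamma> a \<in> \<O>))"

text \<open>\<open>\<CC>\<^sub>g(G)\<close>, \<open>\<CC>\<^sub>f\<^sub>g(G)\<close> and \<open>\<CC>\<^sub>i\<^sub>g(G)\<close> for a set \<open>\<Gamma>\<close> of elements of \<open>G\<close>. In the library, elements of
  infinite order have \<open>ord\<close> equal to 0.\<close>

definition gen_classes :: "('g, 'm) monoid_scheme \<Rightarrow> 'g set \<Rightarrow> 'g set set" where
  "gen_classes G \<Gamma> = {\<O> \<in> conj_classes G. \<O> \<inter> \<Gamma> \<noteq> {}}"

definition fin_gen_classes :: "('g, 'm) monoid_scheme \<Rightarrow> 'g set \<Rightarrow> 'g set set" where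
  "fin_gen_classes G \<Gamma> = {\<O> \<in> gen_classes G \<Gamma>. \<forall>a\<in>\<O>. group.ord G a \<noteq> 0}"

definition inf_gen_classes :: "('g, 'm) monoid_scheme \<Rightarrow> 'g set \<Rightarrow> 'g set set" where
  "inf_gen_classes G \<Gamma> = {\<O> \<in> gen_classes G \<Gamma>. \<forall>a\<in>\<O>. group.ord G a = 0}"

definition dehn_quandle :: "('g, 'm) monoid_scheme \<Rightarrow> 'g set \<Rightarrow> 'g set" where
  "dehn_quandle G \<Gamma> = (\<Union>a\<in>\<Gamma>. conj_class G a)"

definition dehn_rels :: "('g, 'm) monoid_scheme \<Rightarrow> 'g set \<Rightarrow> ('g word \<times> 'g word) set" where
  "dehn_rels G \<Gamma> =
     {([(a, True), (b, True)], [(b, True), (conj_op G a b, True)]) | a b.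
        a \<in> dehn_quandle G \<Gamma> \<and> b \<in> dehn_quandle G \<Gamma>}"

definition dehn_group :: "('g, 'm) monoid_scheme \<Rightarrow> 'g set \<Rightarrow> 'g word set monoid" where
  "dehn_group G \<Gamma> = presented_group (dehn_quandle G \<Gamma>) (dehn_rels G \<Gamma>)"

definition dehn_gen :: "('g, 'm) monoid_scheme \<Rightarrow> 'g set \<Rightarrow> 'g \<Rightarrow> 'g word set" where
  "dehn_gen G \<Gamma> a = word_class (dehn_quandle G \<Gamma>) (dehn_rels G \<Gamma>) [(a, True)]"

definition dehn_proj :: "('g, 'm) monoid_scheme \<Rightarrow> 'g word set \<Rightarrow> 'g" where
  "dehn_proj G = presented_lift G (\<lambda>a. a)"

definition dehn_ab :: "('g, 'm) monoid_scheme \<Rightarrow> 'g set \<Rightarrow> 'g word set \<Rightarrow> ('g set \<Rightarrow>\<^sub>0 int)" where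
  "dehn_ab G \<Gamma> =
     presented_lift (free_Abelian_group (gen_classes G \<Gamma>)) (\<lambda>a. frag_of (conj_class G a))"

definition fin_proj :: "('g, 'm) monoid_scheme \<Rightarrow> 'g set \<Rightarrow> ('g set \<Rightarrow>\<^sub>0 int) \<Rightarrow> ('g set \<Rightarrow>\<^sub>0 int)" where
  "fin_proj G \<Gamma> = frag_extend (\<lambda>\<O>. if \<O> \<in> fin_gen_classes G \<Gamma> then frag_of \<O> else 0)"

definition dehn_ab_fin ::
    "('g, 'm) monoid_scheme \<Rightarrow> 'g set \<Rightarrow> 'g word set \<Rightarrow> ('g set \<Rightarrow>\<^sub>0 int)" where
  "dehn_ab_fin G \<Gamma> = fin_proj G \<Gamma> \<circ> dehn_ab G \<Gamma>"

lemma words_simps [simp]: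
  "[] \<in> words X" "(x, b) # w \<in> words X \<longleftrightarrow> x \<in> X \<and> w \<in> words X"
  "u @ v \<in> words X \<longleftrightarrow> u \<in> words X \<and> v \<in> words X"
  by (auto simp: words_def)

lemma word_cong_words:
  assumes "word_cong X R u v" shows "u \<in> words X \<and> v \<in> words X"
  using assms by induction auto

lemma word_class_eq_iff:
  assumes "u \<in> words X"
  shows "word_class X R u = word_class X R v \<longleftrightarrow> word_cong X R u v"
  using assms unfolding word_class_def
  by (auto intro: word_cong.refl word_cong.sym word_cong.trans)

lemma presented_mult:
  assumes "u \<in> words X" "v \<in> words X"
  shows "word_class X R u \<otimes>\<^bsub>presented_group X R\<^esub> word_class X R v = word_class X R (u @ v)"
proof -
  have "word_class X R (u' @ v') = word_class X R (u @ v)"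
    if "u' \<in> word_class X R u" "v' \<in> word_class X R v" for u' v'
    using that assms word_class_eq_iff[of "u @ v" X R "u' @ v'"]
    by (simp add: word_class_def word_cong.app)
  moreover have "u \<in> word_class X R u" "v \<in> word_class X R v"
    using assms by (auto simp: word_class_def intro: word_cong.refl)
  ultimately have "(\<Union>u'\<in>word_class X R u. \<Union>v'\<in>word_class X R v. word_class X R (u' @ v'))
      = word_class X R (u @ v)"
    by blast
  then show ?thesis by (simp add: presented_group_def)
qed

definition word_inv :: "'x word \<Rightarrow> 'x word" where
  "word_inv w = rev (map (\<lambda>(x, b). (x, \<not> b)) w)"

lemma word_inv_words: "w \<in> words X \<Longrightarrow> word_inv w \<in> words X"
  by (induction w) (auto simp: word_inv_def)

lemma word_inv_left:
  assumes "w \<in> words X" shows "word_cong X R (word_inv w @ w) []"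
  using assms
proof (induction w)
  case Nil
  then show ?case by (simp add: word_inv_def word_cong.refl)
next
  case (Cons p w)
  obtain x b where p: "p = (x, b)" by (cases p)
  have w: "w \<in> words X" "x \<in> X" using Cons.prems p by auto
  have c: "word_cong X R [(x, \<not> b), (x, b)] []"
    using word_cong.cancel[of x X R "\<not> b"] w by simp
  have "word_cong X R (word_inv w @ ([(x, \<not> b), (x, b)] @ w)) (word_inv w @ ([] @ w))"
    using w c by (intro word_cong.app word_cong.refl word_inv_words)
  then show ?case
    using Cons.IH[OF w(1)] p by (auto simp: word_inv_def intro: word_cong.trans)
qed

lemma presented_carrier: "carrier (presented_group X R) = word_class X R ` words X"
  by (simp add: presented_group_def)

lemma presented_one: "\<one>\<^bsub>presented_group X R\<^esub> = word_class X R []"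
  by (simp add: presented_group_def)

lemma presented_group_group: "group (presented_group X R)"
proof (rule groupI)
  show "\<exists>y\<in>carrier (presented_group X R). y \<otimes>\<^bsub>presented_group X R\<^esub> x = \<one>\<^bsub>presented_group X R\<^esub>"
    if x: "x \<in> carrier (presented_group X R)" for x
  proof -
    obtain w where w: "w \<in> words X" "x = word_class X R w"
      using x by (auto simp: presented_carrier)
    have "word_class X R (word_inv w @ w) = word_class X R []"
      using w word_inv_left[OF w(1)] word_inv_words[OF w(1)] by (simp add: word_class_eq_iff)
    then show ?thesis
      using w word_inv_words[OF w(1)]
      by (intro bexI[of _ "word_class X R (word_inv w)"])
         (auto simp: presented_mult presented_one presented_carrier)
  qed
qed (auto simp: presented_carrier presented_one presented_mult)

context group
begin

lemma word_eval_closed: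
  "f \<in> X \<rightarrow> carrier G \<Longrightarrow> w \<in> words X \<Longrightarrow> word_eval G f w \<in> carrier G"
  by (induction w) (auto simp: word_eval_def Pi_iff)

lemma word_eval_append:
  assumes "f \<in> X \<rightarrow> carrier G" "u \<in> words X" "v \<in> words X"
  shows "word_eval G f (u @ v) = word_eval G f u \<otimes> word_eval G f v"
  using assms(2)
proof (induction u)
  case Nil
  then show ?case using word_eval_closed[OF assms(1,3)] by (simp add: word_eval_def)
next
  case (Cons p u)
  obtain x b where p: "p = (x, b)" by (cases p)
  have "x \<in> X" "u \<in> words X" using Cons.prems p by auto
  then show ?case
    using Cons.IH p assms(1) word_eval_closed[OF assms(1,3)] word_eval_closed[OF assms(1) \<open>u \<in> words X\<close>]
    by (auto simp: word_eval_def m_assoc Pi_iff)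
qed

lemma word_eval_cong:
  assumes "word_cong X R u v" "f \<in> X \<rightarrow> carrier G"
    and "\<And>u v. (u, v) \<in> R \<Longrightarrow> word_eval G f u = word_eval G f v"
  shows "word_eval G f u = word_eval G f v"
  using assms(1)
proof induction
  case (app u v u' v')
  then show ?case
    using word_eval_append[OF assms(2)] word_cong_words[OF app(1)] word_cong_words[OF app(2)]
    by simp
next
  case (cancel x b)
  then show ?case using assms(2) by (auto simp: word_eval_def Pi_iff)
qed (use assms(3) in auto)

lemma presented_lift_word_class:
  assumes "f \<in> X \<rightarrow> carrier G" "\<And>u v. (u, v) \<in> R \<Longrightarrow> word_eval G f u = word_eval G f v"
    and "w \<in> words X"
  shows "presented_lift G f (word_class X R w) = word_eval G f w"
proof -
  have "word_eval G f ` word_class X R w = {word_eval G f w}"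
  proof (intro equalityI subsetI)
    fix y assume "y \<in> word_eval G f ` word_class X R w"
    then obtain v where v: "word_cong X R w v" "y = word_eval G f v"
      by (auto simp: word_class_def)
    have "word_eval G f w = word_eval G f v"
      by (rule word_eval_cong[OF v(1) assms(1)]) (rule assms(2))
    then show "y \<in> {word_eval G f w}" using v by simp
  next
    fix y assume "y \<in> {word_eval G f w}"
    moreover have "w \<in> word_class X R w"
      using assms(3) by (simp add: word_class_def word_cong.refl)
    ultimately show "y \<in> word_eval G f ` word_class X R w" by simp
  qed
  then show ?thesis by (simp add: presented_lift_def)
qed

lemma presented_lift_hom:
  assumes "f \<in> X \<rightarrow> carrier G" "\<And>u v. (u, v) \<in> R \<Longrightarrow> word_eval G f u = word_eval G f v"
  shows "presented_lift G f \<in> hom (presented_group X R) G"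
  by (rule homI)
     (auto simp: presented_carrier presented_mult presented_lift_word_class[OF assms]
        word_eval_append[OF assms(1)] word_eval_closed[OF assms(1)])

lemma conj_op_closed:
  "a \<in> carrier G \<Longrightarrow> b \<in> carrier G \<Longrightarrow> conj_op G a b \<in> carrier G"
  by (simp add: conj_op_def)

lemma conj_op_conj_op:
  assumes "a \<in> carrier G" "b \<in> carrier G" "c \<in> carrier G"
  shows "conj_op G (conj_op G a b) c = conj_op G a (b \<otimes> c)"
  using assms by (simp add: conj_op_def m_assoc inv_mult_group)

lemma conj_class_self: "a \<in> carrier G \<Longrightarrow> a \<in> conj_class G a"
  unfolding conj_class_def by (rule image_eqI[of _ _ \<one>]) (auto simp: conj_op_def)

lemma conj_class_conj_op:
  assumes "a \<in> carrier G" "b \<in> carrier G"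
  shows "conj_class G (conj_op G a b) = conj_class G a"
proof -
  have sub: "conj_class G (conj_op G a b) \<subseteq> conj_class G a"
    if "a \<in> carrier G" "b \<in> carrier G" for a b
    using that by (auto simp: conj_class_def conj_op_conj_op)
  have "conj_op G (conj_op G a b) (inv b) = a"
    using assms by (simp add: conj_op_conj_op) (simp add: conj_op_def)
  then show ?thesis
    using sub[OF assms] sub[OF conj_op_closed[OF assms], of "inv b"] assms by auto
qed

lemma dehn_quandle_carrier: "\<Gamma> \<subseteq> carrier G \<Longrightarrow> dehn_quandle G \<Gamma> \<subseteq> carrier G"
  by (auto simp: dehn_quandle_def conj_class_def conj_op_closed)

lemma dehn_quandle_conj_op:
  assumes "\<Gamma> \<subseteq> carrier G" "a \<in> dehn_quandle G \<Gamma>" "b \<in> carrier G"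
  shows "conj_op G a b \<in> dehn_quandle G \<Gamma>"
  using assms by (fastforce simp: dehn_quandle_def conj_class_def conj_op_conj_op)

lemma conj_class_gen_classes:
  assumes "\<Gamma> \<subseteq> carrier G" "a \<in> dehn_quandle G \<Gamma>"
  shows "conj_class G a \<in> gen_classes G \<Gamma>"
proof -
  obtain x g where x: "x \<in> \<Gamma>" "g \<in> carrier G" "a = conj_op G x g"
    using assms by (auto simp: dehn_quandle_def conj_class_def)
  then have "conj_class G a = conj_class G x" "x \<in> carrier G"
    using assms conj_class_conj_op by auto
  then show ?thesis
    using x conj_class_self by (auto simp: gen_classes_def conj_classes_def)
qed

lemma ord_conj_op:
  assumes "a \<in> carrier G" "b \<in> carrier G"
  shows "ord (conj_op G a b) = ord a"
proof -
  have pow: "conj_op G a b [^] n = conj_op G (a [^] n) b" for n :: nat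
  proof (induction n)
    case 0
    then show ?case using assms by (simp add: conj_op_def)
  next
    case (Suc n)
    have "b \<otimes> (inv b \<otimes> (a \<otimes> b)) = a \<otimes> b"
      using assms by (simp flip: m_assoc)
    then have "conj_op G (a [^] n) b \<otimes> conj_op G a b = conj_op G (a [^] Suc n) b"
      using assms by (simp add: conj_op_def m_assoc)
    then show ?case using Suc by simp
  qed
  have "conj_op G c b = \<one> \<longleftrightarrow> c = \<one>" if "c \<in> carrier G" for c
  proof
    assume "conj_op G c b = \<one>"
    then have "b \<otimes> conj_op G c b \<otimes> inv b = \<one>" using assms by simp
    moreover have "b \<otimes> (inv b \<otimes> c) = c"
      using assms that by (simp flip: m_assoc)
    then have "b \<otimes> conj_op G c b \<otimes> inv b = c"
      using assms that by (simp add: conj_op_def m_assoc)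
    ultimately show "c = \<one>" using assms that by simp
  qed (use assms in \<open>simp add: conj_op_def\<close>)
  then have "conj_op G a b [^] n = \<one> \<longleftrightarrow> a [^] n = \<one>" for n :: nat
    using assms by (simp add: pow)
  then show ?thesis
    using assms pow_eq_id conj_op_closed by (metis dvd_antisym dvd_refl)
qed

lemma gen_classes_disjoint_union:
  "gen_classes G \<Gamma> = fin_gen_classes G \<Gamma> \<union> inf_gen_classes G \<Gamma>"
  "fin_gen_classes G \<Gamma> \<inter> inf_gen_classes G \<Gamma> = {}"
  by (auto simp: fin_gen_classes_def inf_gen_classes_def gen_classes_def conj_classes_def
      conj_class_def ord_conj_op)

lemma dehn_proj_respects:
  assumes "\<Gamma> \<subseteq> carrier G" "(u, v) \<in> dehn_rels G \<Gamma>"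
  shows "word_eval G (\<lambda>a. a) u = word_eval G (\<lambda>a. a) v"
proof -
  obtain a b where ab: "a \<in> carrier G" "b \<in> carrier G"
    "u = [(a, True), (b, True)]" "v = [(b, True), (conj_op G a b, True)]"
    using assms dehn_quandle_carrier[OF assms(1)] by (auto simp: dehn_rels_def)
  then have "b \<otimes> conj_op G a b = a \<otimes> b"
    by (simp add: conj_op_def m_assoc flip: m_assoc[of b "inv b"])
  then show ?thesis using ab by (simp add: word_eval_def conj_op_closed)
qed

lemma
  assumes "\<Gamma> \<subseteq> carrier G"
  shows dehn_proj_hom: "dehn_proj G \<in> hom (dehn_group G \<Gamma>) G"
    and dehn_proj_gen: "a \<in> dehn_quandle G \<Gamma> \<Longrightarrow> dehn_proj G (dehn_gen G \<Gamma> a) = a"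
proof -
  have f: "(\<lambda>a. a) \<in> dehn_quandle G \<Gamma> \<rightarrow> carrier G"
    using dehn_quandle_carrier[OF assms] by auto
  note r = dehn_proj_respects[OF assms]
  show "dehn_proj G \<in> hom (dehn_group G \<Gamma>) G"
    unfolding dehn_proj_def dehn_group_def by (rule presented_lift_hom[OF f r])
  show "dehn_proj G (dehn_gen G \<Gamma> a) = a" if "a \<in> dehn_quandle G \<Gamma>"
  proof -
    have "dehn_proj G (dehn_gen G \<Gamma> a) = word_eval G (\<lambda>a. a) [(a, True)]"
      unfolding dehn_proj_def dehn_gen_def
      by (rule presented_lift_word_class[OF f r]) (use that in auto)
    then show ?thesis using that dehn_quandle_carrier[OF assms] by (auto simp: word_eval_def)
  qed
qed

lemma dehn_ab_respects:
  assumes "\<Gamma> \<subseteq> carrier G" "(u, v) \<in> dehn_rels G \<Gamma>"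
  shows "word_eval (free_Abelian_group (gen_classes G \<Gamma>)) (\<lambda>a. frag_of (conj_class G a)) u
       = word_eval (free_Abelian_group (gen_classes G \<Gamma>)) (\<lambda>a. frag_of (conj_class G a)) v"
  using assms dehn_quandle_carrier[OF assms(1)]
  by (auto simp: dehn_rels_def word_eval_def conj_class_conj_op subset_iff)

lemma
  assumes "\<Gamma> \<subseteq> carrier G"
  shows dehn_ab_hom: "dehn_ab G \<Gamma> \<in> hom (dehn_group G \<Gamma>) (free_Abelian_group (gen_classes G \<Gamma>))"
    and dehn_ab_gen:
      "a \<in> dehn_quandle G \<Gamma> \<Longrightarrow> dehn_ab G \<Gamma> (dehn_gen G \<Gamma> a) = frag_of (conj_class G a)"
proof -
  interpret Z: group "free_Abelian_group (gen_classes G \<Gamma>)" by simp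
  have f: "(\<lambda>a. frag_of (conj_class G a)) \<in>
      dehn_quandle G \<Gamma> \<rightarrow> carrier (free_Abelian_group (gen_classes G \<Gamma>))"
    using conj_class_gen_classes[OF assms] by auto
  note r = dehn_ab_respects[OF assms]
  show "dehn_ab G \<Gamma> \<in> hom (dehn_group G \<Gamma>) (free_Abelian_group (gen_classes G \<Gamma>))"
    unfolding dehn_ab_def dehn_group_def by (rule Z.presented_lift_hom[OF f r])
  show "dehn_ab G \<Gamma> (dehn_gen G \<Gamma> a) = frag_of (conj_class G a)" if "a \<in> dehn_quandle G \<Gamma>"
  proof -
    have "dehn_ab G \<Gamma> (dehn_gen G \<Gamma> a) =
        word_eval (free_Abelian_group (gen_classes G \<Gamma>)) (\<lambda>a. frag_of (conj_class G a)) [(a, True)]"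
      unfolding dehn_ab_def dehn_gen_def
      by (rule Z.presented_lift_word_class[OF f r]) (use that in auto)
    then show ?thesis by (simp add: word_eval_def)
  qed
qed

lemma fin_proj_hom:
  "fin_proj G \<Gamma> \<in> hom (free_Abelian_group (gen_classes G \<Gamma>)) (free_Abelian_group (fin_gen_classes G \<Gamma>))"
proof (rule homI)
  fix x
  have "Poly_Mapping.keys (fin_proj G \<Gamma> x) \<subseteq> (\<Union>\<O>\<in>Poly_Mapping.keys x.
      Poly_Mapping.keys (if \<O> \<in> fin_gen_classes G \<Gamma> then frag_of \<O> else 0))"
    unfolding fin_proj_def by (rule keys_frag_extend)
  also have "\<dots> \<subseteq> fin_gen_classes G \<Gamma>"
    by (rule UN_least) simp
  finally show "fin_proj G \<Gamma> x \<in> carrier (free_Abelian_group (fin_gen_classes G \<Gamma>))"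
    by simp
qed (simp add: fin_proj_def frag_extend_add)

lemma dehn_ab_fin_hom:
  assumes "\<Gamma> \<subseteq> carrier G"
  shows "dehn_ab_fin G \<Gamma> \<in> hom (dehn_group G \<Gamma>) (free_Abelian_group (fin_gen_classes G \<Gamma>))"
  unfolding dehn_ab_fin_def by (rule Group.hom_compose[OF dehn_ab_hom[OF assms] fin_proj_hom])

end

end

theory Submission
  imports Defs
begin

text \<open>
  In \<open>D = G\<^sup>D\<close> one has \<open>z\<^sup>-\<^sup>1 e\<^sub>a z = e\<^sub>b\<close> with \<open>b = \<pi>(z)\<^sup>-\<^sup>1 a \<pi>(z)\<close>. Hence the kernel of \<open>\<pi>\<close> is
  central, and \<open>D\<close> is generated by the elements \<open>e\<^sub>x\<close> with \<open>x \<in> \<Gamma>\<close>. These satisfy the conjugation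
  relations of \<open>\<Pi>\<close>, and they satisfy the power relations \<open>x\<^sup>k = 1\<close> modulo the central subgroup \<open>T\<close>
  generated by the corresponding \<open>e\<^sub>x\<^sup>k\<close>, so the kernel of \<open>\<pi>\<close> is contained in \<open>T\<close>. Since \<open>Ab\<^sub>f\<close>
  sends \<open>e\<^sub>x\<^sup>k\<close> to \<open>k c\<^sub>\<O>\<close> with \<open>x \<in> \<O>\<close>, and each class \<open>\<O>\<close> carries at most one power relation, the
  images of the generators of the abelian group \<open>T\<close> are linearly independent. Therefore \<open>Ab\<^sub>f\<close> is
  injective on \<open>T\<close>.
\<close>

lemma (in group_hom) inj_on_Pair_hom:
  assumes "group_hom G K k" "inj_on k (kernel G H h)"
  shows "inj_on (\<lambda>x. (h x, k x)) (carrier G)"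
proof (rule inj_onI)
  interpret k: group_hom G K k by fact
  fix x y
  assume xy: "x \<in> carrier G" "y \<in> carrier G" "(h x, k x) = (h y, k y)"
  then have "x \<otimes> inv y \<in> kernel G H h" "k (x \<otimes> inv y) = k \<one>"
    by (auto simp: kernel_def)
  moreover have "\<one> \<in> kernel G H h" by (simp add: kernel_def)
  ultimately have "x \<otimes> inv y = \<one>" by (intro inj_onD[OF assms(2)])
  then show "x = y" using xy G.inv_solve_right[of \<one> x y] by simp
qed

lemma inj_on_hom_free_Abelian_groups:
  assumes h: "h \<in> hom (free_Abelian_group A) (free_Abelian_group B)"
    and c: "inj_on c A"
    and h_of: "\<And>a. a \<in> A \<Longrightarrow> h (frag_of a) = frag_cmul (n a) (frag_of (c a))"
    and n: "\<And>a. a \<in> A \<Longrightarrow> n a \<noteq> 0"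
  shows "inj_on h (carrier (free_Abelian_group A))"
proof (rule inj_onI, rule poly_mapping_eqI)
  interpret h: group_hom "free_Abelian_group A" "free_Abelian_group B" h
    by (intro group_hom.intro group_hom_axioms.intro h) simp_all
  have lookup_h: "Poly_Mapping.lookup (h x) (c a) = n a * Poly_Mapping.lookup x a"
    if "Poly_Mapping.keys x \<subseteq> A" "a \<in> A" for x a
    using that(1)
  proof (induction x rule: free_Abelian_group_induct[consumes 1, case_names zero diff basis])
    case zero
    show ?case using h.hom_one by simp
  next
    case (diff x y)
    have "Poly_Mapping.keys (x - y) \<subseteq> A" using diff keys_diff[of x y] by blast
    then have "h x = h (x - y) + h y"
      using h.hom_mult[of "x - y" y] diff by simp
    then show ?case using diff by (simp add: lookup_add lookup_minus right_diff_distrib)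
  next
    case (basis b)
    then show ?case
      using that(2) c by (auto simp: h_of lookup_single when_def dest: inj_onD)
  qed
  fix x y a
  assume xy: "x \<in> carrier (free_Abelian_group A)" "y \<in> carrier (free_Abelian_group A)" "h x = h y"
  show "Poly_Mapping.lookup x a = Poly_Mapping.lookup y a"
  proof (cases "a \<in> A")
    case True
    then show ?thesis using lookup_h[of x a] lookup_h[of y a] xy n by simp
  next
    case False
    then show ?thesis using xy by (metis carrier_free_Abelian_group_iff in_keys_iff subset_iff)
  qed
qed

definition centralizer :: "('a, 'b) monoid_scheme \<Rightarrow> 'a set \<Rightarrow> 'a set" where
  "centralizer G A = {x \<in> carrier G. \<forall>a\<in>A. x \<otimes>\<^bsub>G\<^esub> a = a \<otimes>\<^bsub>G\<^esub> x}"

lemma centralizer_anti_mono: "A \<subseteq> B \<Longrightarrow> centralizer G B \<subseteq> centralizer G A"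
  by (auto simp: centralizer_def)

context group
begin

lemma subset_centralizer_commute:
  assumes "A \<subseteq> carrier G" "B \<subseteq> carrier G"
  shows "A \<subseteq> centralizer G B \<longleftrightarrow> B \<subseteq> centralizer G A"
  using assms by (auto simp: centralizer_def)

lemma subgroup_centralizer:
  assumes "A \<subseteq> carrier G"
  shows "subgroup (centralizer G A) G"
proof (rule subgroupI)
  show "centralizer G A \<noteq> {}" using assms by (auto simp: centralizer_def intro!: exI[of _ \<one>])
next
  fix x assume x: "x \<in> centralizer G A"
  have "inv x \<otimes> a = a \<otimes> inv x" if "a \<in> A" for a
  proof -
    have "a \<in> carrier G" "x \<in> carrier G" "x \<otimes> a = a \<otimes> x"
      using assms x that by (auto simp: centralizer_def)
    then show ?thesis by (metis inv_closed inv_solve_left inv_solve_right m_assoc m_closed)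
  qed
  then show "inv x \<in> centralizer G A" using x by (simp add: centralizer_def)
next
  fix x y assume xy: "x \<in> centralizer G A" "y \<in> centralizer G A"
  have "x \<otimes> y \<otimes> a = a \<otimes> (x \<otimes> y)" if "a \<in> A" for a
  proof -
    have "x \<otimes> a = a \<otimes> x" "y \<otimes> a = a \<otimes> y" "a \<in> carrier G" "x \<in> carrier G" "y \<in> carrier G"
      using assms xy that by (auto simp: centralizer_def)
    then show ?thesis by (metis m_assoc)
  qed
  then show "x \<otimes> y \<in> centralizer G A" using xy by (simp add: centralizer_def)
qed (simp add: centralizer_def)

lemma central_subgroup_normal:
  assumes "subgroup T G" "T \<subseteq> centralizer G (carrier G)"
  shows "T \<lhd> G"
proof -
  have "x \<otimes> t \<otimes> inv x = t" if "x \<in> carrier G" "t \<in> T" for x t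
  proof -
    have "x \<otimes> t = t \<otimes> x" "t \<in> carrier G"
      using assms(2) that by (auto simp: centralizer_def)
    then show ?thesis using that by (simp add: m_assoc)
  qed
  then show ?thesis using assms(1) by (simp add: normal_inv_iff)
qed

lemma comm_group_subgroup_generated:
  assumes "S \<subseteq> centralizer G S"
  shows "comm_group (subgroup_generated G S)"
proof -
  have S: "S \<subseteq> carrier G" using assms by (auto simp: centralizer_def)
  have "generate G S \<subseteq> centralizer G S"
    using assms subgroup_centralizer[OF S] by (rule generate_subgroup_incl)
  then have "S \<subseteq> centralizer G (generate G S)"
    using subset_centralizer_commute[OF S generate_incl[OF S]] by simp
  then have "generate G S \<subseteq> centralizer G (generate G S)"
    using subgroup_centralizer[OF generate_incl[OF S]] by (rule generate_subgroup_incl)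
  then show ?thesis
    using S by (intro group.group_comm_groupI)
      (auto simp: carrier_subgroup_generated Int_absorb1 centralizer_def)
qed

lemma inj_on_generate_hom_free_Abelian_group:
  assumes t: "t ` I \<subseteq> centralizer G (t ` I)"
    and h: "h \<in> hom G (free_Abelian_group B)"
    and c: "inj_on c I"
    and h_t: "\<And>i. i \<in> I \<Longrightarrow> h (t i) = frag_cmul (n i) (frag_of (c i))"
    and n: "\<And>i. i \<in> I \<Longrightarrow> n i \<noteq> 0"
  shows "inj_on h (generate G (t ` I))"
proof -
  let ?F = "free_Abelian_group I" and ?T = "subgroup_generated G (t ` I)"
  have "t ` I \<subseteq> carrier G" using t by (auto simp: centralizer_def)
  then have "t ` I \<subseteq> carrier ?T" by (rule subgroup_generated_subset_carrier_subset)
  then obtain g where "g \<in> hom ?F ?T" and g_of: "\<And>i. i \<in> I \<Longrightarrow> g (frag_of i) = t i"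
    using comm_group.free_Abelian_group_universal[OF comm_group_subgroup_generated[OF t]] by blast
  then have "g \<in> hom ?F G" by (simp add: hom_into_subgroup_eq_gen is_group)
  then interpret g: group_hom ?F G g
    by (intro group_hom.intro group_hom_axioms.intro is_group) simp_all
  have "inj_on (h \<circ> g) (carrier ?F)"
  proof (rule inj_on_hom_free_Abelian_groups[OF _ c _ n])
    show "h \<circ> g \<in> hom ?F (free_Abelian_group B)" using g.homh h by (rule Group.hom_compose)
  qed (simp_all add: g_of h_t)
  then have "inj_on h (g ` carrier ?F)" by (rule inj_on_imageI)
  moreover have "t i \<in> g ` carrier ?F" if "i \<in> I" for i
    using that by (intro image_eqI[of _ _ "frag_of i"]) (simp_all add: g_of)
  then have "generate G (t ` I) \<subseteq> g ` carrier ?F"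
    by (intro generate_subgroup_incl g.img_is_subgroup) auto
  ultimately show ?thesis by (rule inj_on_subset)
qed

lemma conj_op_eq_iff:
  assumes "a \<in> carrier G" "b \<in> carrier G" "c \<in> carrier G"
  shows "conj_op G a b = c \<longleftrightarrow> a \<otimes> b = b \<otimes> c"
  using assms by (simp add: conj_op_def m_assoc inv_solve_left')

lemma conj_op_one: "a \<in> carrier G \<Longrightarrow> conj_op G a \<one> = a"
  by (simp add: conj_op_def)

lemma conj_op_inv_cancel:
  assumes "a \<in> carrier G" "b \<in> carrier G"
  shows "conj_op G (conj_op G a b) (inv b) = a" "conj_op G (conj_op G a (inv b)) b = a"
  using assms by (simp_all add: conj_op_conj_op conj_op_one)

end

lemma word_eval_Nil [simp]: "word_eval G f [] = \<one>\<^bsub>G\<^esub>"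
  by (simp add: word_eval_def)

lemma word_eval_Cons [simp]:
  "word_eval G f ((x, b) # w) = (if b then f x else inv\<^bsub>G\<^esub> f x) \<otimes>\<^bsub>G\<^esub> word_eval G f w"
  by (simp add: word_eval_def)

lemma (in group_hom) hom_word_eval:
  assumes "f \<in> X \<rightarrow> carrier G" "w \<in> words X"
  shows "h (word_eval G f w) = word_eval H (h \<circ> f) w"
  using assms(2)
proof (induction w)
  case (Cons p w)
  obtain x b where p: "p = (x, b)" by (cases p)
  have "x \<in> X" "w \<in> words X" using Cons.prems p by auto
  then show ?case using Cons.IH p assms(1) G.word_eval_closed[OF assms(1)] by (auto simp: Pi_iff)
qed simp

lemma word_eval_fun_cong:
  assumes "w \<in> words X" "\<And>x. x \<in> X \<Longrightarrow> f x = g x"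
  shows "word_eval G f w = word_eval G g w"
  unfolding word_eval_def by (rule foldr_cong) (use assms in \<open>auto simp: words_def\<close>)

context group
begin

lemma generate_image_eq_word_eval:
  assumes f: "f \<in> X \<rightarrow> carrier G"
  shows "generate G (f ` X) = word_eval G f ` words X"
proof (intro equalityI subsetI)
  fix z assume "z \<in> generate G (f ` X)"
  then show "z \<in> word_eval G f ` words X"
  proof induction
    case one
    show ?case by (rule image_eqI[of _ _ "[]"]) simp_all
  next
    case (incl z)
    then obtain x where "x \<in> X" "z = f x" by blast
    then show ?case using f by (intro image_eqI[of _ _ "[(x, True)]"]) (auto simp: Pi_iff)
  next
    case (inv z)
    then obtain x where "x \<in> X" "z = f x" by blast
    then show ?case using f by (intro image_eqI[of _ _ "[(x, False)]"]) (auto simp: Pi_iff)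
  next
    case (eng y z)
    then obtain u v where "u \<in> words X" "v \<in> words X" "y = word_eval G f u" "z = word_eval G f v"
      by blast
    then show ?case by (intro image_eqI[of _ _ "u @ v"]) (simp_all add: word_eval_append[OF f])
  qed
next
  have "word_eval G f w \<in> generate G (f ` X)" if "w \<in> words X" for w
    using that by (induction w) (auto simp: generate.intros)
  then show "z \<in> generate G (f ` X)" if "z \<in> word_eval G f ` words X" for z
    using that by blast
qed

lemma word_eval_replicate:
  "f x \<in> carrier G \<Longrightarrow> word_eval G f (replicate k (x, True)) = f x [^] k"
  by (induction k) (simp_all add: group_commutes_pow)

lemma word_eval_conj_rel:
  assumes "f a \<in> carrier G" "f b \<in> carrier G" "f c \<in> carrier G"
  shows "word_eval G f (fst (conj_rel a b c)) = conj_op G (f a) (f b)"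
    and "word_eval G f (snd (conj_rel a b c)) = f c"
  using assms by (simp_all add: conj_rel_def conj_op_def m_assoc)

lemma word_eval_power_rel:
  assumes "f a \<in> carrier G"
  shows "word_eval G f (fst (power_rel a k)) = f a [^] k"
    and "word_eval G f (snd (power_rel a k)) = \<one>"
  using assms by (simp_all add: power_rel_def word_eval_replicate)

end

lemma word_class_eq_word_eval:
  assumes "w \<in> words X"
  shows "word_class X R w = word_eval (presented_group X R) (\<lambda>x. word_class X R [(x, True)]) w"
  using assms
proof (induction w)
  case Nil
  show ?case by (simp add: presented_one)
next
  interpret P: group "presented_group X R" by (rule presented_group_group)
  case (Cons p w)
  obtain x b where p: "p = (x, b)" by (cases p)
  have w: "x \<in> X" "w \<in> words X" using Cons.prems p by auto
  have "inv\<^bsub>presented_group X R\<^esub> word_class X R [(x, True)] = word_class X R [(x, False)]"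
  proof (rule P.inv_equality)
    show "word_class X R [(x, False)] \<otimes>\<^bsub>presented_group X R\<^esub> word_class X R [(x, True)]
        = \<one>\<^bsub>presented_group X R\<^esub>"
      using w word_cong.cancel[of x X R False]
      by (simp add: presented_mult presented_one word_class_eq_iff)
  qed (use w in \<open>auto simp: presented_carrier\<close>)
  then show ?case
    using Cons.IH w presented_mult[of "[(x, b)]" X w R] by (cases b) (simp_all add: p)
qed

lemma generate_presented_group:
  "generate (presented_group X R) ((\<lambda>x. word_class X R [(x, True)]) ` X)
     = carrier (presented_group X R)"
proof -
  interpret P: group "presented_group X R" by (rule presented_group_group)
  have "(\<lambda>x. word_class X R [(x, True)]) \<in> X \<rightarrow> carrier (presented_group X R)"
    by (simp add: presented_carrier)
  then show ?thesis
    by (simp add: P.generate_image_eq_word_eval presented_carrier flip: word_class_eq_word_eval)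
qed

context group
begin

lemma presented_lift_presentation:
  assumes "is_presentation G X \<gamma> R" "w \<in> words X"
  shows "presented_lift G \<gamma> (word_class X R w) = word_eval G \<gamma> w"
  by (rule presented_lift_word_class) (use assms in \<open>auto simp: is_presentation_def\<close>)

lemma generate_presentation:
  assumes "is_presentation G X \<gamma> R"
  shows "generate G (\<gamma> ` X) = carrier G"
proof -
  have "\<gamma> \<in> X \<rightarrow> carrier G" using assms by (simp add: is_presentation_def)
  then have "generate G (\<gamma> ` X) = word_eval G \<gamma> ` words X" by (rule generate_image_eq_word_eval)
  also have "\<dots> = presented_lift G \<gamma> ` carrier (presented_group X R)"
    by (simp add: presented_carrier image_image presented_lift_presentation[OF assms])
  also have "\<dots> = carrier G" using assms by (simp add: is_presentation_def iso_def bij_betw_def)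
  finally show ?thesis .
qed

lemma word_cong_presentation_iff:
  assumes "is_presentation G X \<gamma> R" "u \<in> words X" "v \<in> words X"
  shows "word_cong X R u v \<longleftrightarrow> word_eval G \<gamma> u = word_eval G \<gamma> v"
proof -
  have "inj_on (presented_lift G \<gamma>) (carrier (presented_group X R))"
    using assms(1) by (simp add: is_presentation_def iso_def bij_betw_def)
  then have "presented_lift G \<gamma> (word_class X R u) = presented_lift G \<gamma> (word_class X R v)
      \<longleftrightarrow> word_class X R u = word_class X R v"
    using assms by (intro inj_on_eq_iff) (auto simp: presented_carrier)
  then show ?thesis using assms by (simp add: presented_lift_presentation word_class_eq_iff)
qed

end

lemma (in group_hom) kernel_subset_of_presentation:
  assumes pres: "is_presentation H X \<gamma> R"
    and f: "f \<in> X \<rightarrow> carrier G" "generate G (f ` X) = carrier G" "\<And>x. x \<in> X \<Longrightarrow> h (f x) = \<gamma> x"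
    and T: "T \<lhd> G" "\<And>u v. (u, v) \<in> R \<Longrightarrow> T #> word_eval G f u = T #> word_eval G f v"
  shows "kernel G H h \<subseteq> T"
proof
  interpret T: normal T G by fact
  let ?q = "\<lambda>y. T #> y"
  interpret q: group_hom G "G Mod T" ?q
    by (intro group_hom.intro group_hom_axioms.intro T.factorgroup_is_group T.r_coset_hom_Mod)
       unfold_locales
  fix z assume "z \<in> kernel G H h"
  then have z: "z \<in> carrier G" "h z = \<one>\<^bsub>H\<^esub>" by (auto simp: kernel_def)
  then obtain w where w: "w \<in> words X" "z = word_eval G f w"
    using f(2) unfolding G.generate_image_eq_word_eval[OF f(1)] by blast
  have "word_eval H \<gamma> w = word_eval H (h \<circ> f) w"
    by (rule word_eval_fun_cong) (use w f(3) in auto)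
  also have "\<dots> = word_eval H \<gamma> []" using hom_word_eval[OF f(1) w(1)] w(2) z(2) by simp
  finally have cong: "word_cong X R w []"
    using w(1) by (simp add: H.word_cong_presentation_iff[OF pres])
  have "word_eval (G Mod T) (?q \<circ> f) u = word_eval (G Mod T) (?q \<circ> f) v" if "(u, v) \<in> R" for u v
    using that pres T(2) q.hom_word_eval[OF f(1), symmetric] by (auto simp: is_presentation_def)
  then have "word_eval (G Mod T) (?q \<circ> f) w = word_eval (G Mod T) (?q \<circ> f) []"
    using f(1) by (intro q.H.word_eval_cong[OF cong]) (auto simp: Pi_iff)
  then have "T #> z = T" using q.hom_word_eval[OF f(1) w(1)] w(2) by simp
  then show "z \<in> T" using z(1) T.is_subgroup by (rule G.coset_join1)
qed

locale dehn = group G for G (structure) +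
  fixes \<Gamma> :: "'a set"
  assumes generators_closed: "\<Gamma> \<subseteq> carrier G"
begin

abbreviation Q :: "'a set" where "Q \<equiv> dehn_quandle G \<Gamma>"
abbreviation D :: "'a word set monoid" where "D \<equiv> dehn_group G \<Gamma>"
abbreviation e :: "'a \<Rightarrow> 'a word set" where "e \<equiv> dehn_gen G \<Gamma>"
abbreviation \<pi> :: "'a word set \<Rightarrow> 'a" where "\<pi> \<equiv> dehn_proj G"
abbreviation Ab\<^sub>f :: "'a word set \<Rightarrow> ('a set \<Rightarrow>\<^sub>0 int)" where "Ab\<^sub>f \<equiv> dehn_ab_fin G \<Gamma>"

sublocale D: group D
  by (simp add: dehn_group_def presented_group_group)

sublocale \<pi>: group_hom D G \<pi>
  by unfold_locales (rule dehn_proj_hom[OF generators_closed])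

sublocale Ab\<^sub>f: group_hom D "free_Abelian_group (fin_gen_classes G \<Gamma>)" Ab\<^sub>f
  by (intro group_hom.intro group_hom_axioms.intro D.is_group dehn_ab_fin_hom generators_closed)
     simp

lemma dehn_gen_closed: "a \<in> Q \<Longrightarrow> e a \<in> carrier D"
  by (simp add: dehn_gen_def dehn_group_def presented_carrier)

lemma proj_dehn_gen: "a \<in> Q \<Longrightarrow> \<pi> (e a) = a"
  by (rule dehn_proj_gen[OF generators_closed])

lemma generators_subset_dehn_quandle: "\<Gamma> \<subseteq> Q"
  unfolding dehn_quandle_def using generators_closed conj_class_self by blast

lemma dehn_quandle_closed: "a \<in> Q \<Longrightarrow> a \<in> carrier G"
  using dehn_quandle_carrier[OF generators_closed] by auto

lemma conj_op_dehn_quandle: "a \<in> Q \<Longrightarrow> b \<in> carrier G \<Longrightarrow> conj_op G a b \<in> Q"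
  by (rule dehn_quandle_conj_op[OF generators_closed])

lemma generate_dehn_group: "generate D (e ` Q) = carrier D"
  unfolding dehn_group_def dehn_gen_def by (rule generate_presented_group)

lemma conj_op_dehn_gen_gen:
  assumes "a \<in> Q" "b \<in> Q"
  shows "conj_op D (e a) (e b) = e (conj_op G a b)"
proof -
  have c: "conj_op G a b \<in> Q"
    using assms by (simp add: conj_op_dehn_quandle dehn_quandle_closed)
  have "word_cong Q (dehn_rels G \<Gamma>) [(a, True), (b, True)] [(b, True), (conj_op G a b, True)]"
    by (rule word_cong.rel) (use assms c in \<open>auto simp: dehn_rels_def\<close>)
  then have "e a \<otimes>\<^bsub>D\<^esub> e b = e b \<otimes>\<^bsub>D\<^esub> e (conj_op G a b)"
    using assms c by (simp add: dehn_group_def dehn_gen_def presented_mult word_class_eq_iff)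
  then show ?thesis using assms c by (simp add: D.conj_op_eq_iff dehn_gen_closed)
qed

lemma conj_op_dehn_gen:
  assumes "z \<in> carrier D" "a \<in> Q"
  shows "conj_op D (e a) z = e (conj_op G a (\<pi> z))"
proof -
  let ?S = "{z \<in> carrier D. \<forall>a\<in>Q. conj_op D (e a) z = e (conj_op G a (\<pi> z))}"
  have "subgroup ?S D"
  proof (rule D.subgroupI)
    show "?S \<noteq> {}"
      using D.conj_op_one conj_op_one dehn_gen_closed dehn_quandle_closed
      by (auto intro!: exI[of _ "\<one>\<^bsub>D\<^esub>"])
  next
    fix z assume z: "z \<in> ?S"
    have "conj_op D (e a) (inv\<^bsub>D\<^esub> z) = e (conj_op G a (inv (\<pi> z)))" if "a \<in> Q" for a
    proof -
      let ?a' = "conj_op G a (inv (\<pi> z))"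
      have a': "?a' \<in> Q" using z that by (simp add: conj_op_dehn_quandle)
      then have "conj_op D (e ?a') z = e a"
        using z that by (simp add: conj_op_inv_cancel dehn_quandle_closed)
      then show ?thesis
        using z a' D.conj_op_inv_cancel(1)[of "e ?a'" z] by (simp add: dehn_gen_closed)
    qed
    then show "inv\<^bsub>D\<^esub> z \<in> ?S" using z by simp
  next
    fix y z assume "y \<in> ?S" "z \<in> ?S"
    then show "y \<otimes>\<^bsub>D\<^esub> z \<in> ?S"
      by (simp add: conj_op_conj_op[symmetric] D.conj_op_conj_op[symmetric] conj_op_dehn_quandle
          dehn_gen_closed dehn_quandle_closed)
  qed blast
  moreover have "e ` Q \<subseteq> ?S"
    by (auto simp: dehn_gen_closed conj_op_dehn_gen_gen proj_dehn_gen)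
  ultimately have "generate D (e ` Q) \<subseteq> ?S" by (intro D.generate_subgroup_incl)
  then show ?thesis using assms by (auto simp: generate_dehn_group)
qed

lemma kernel_dehn_proj_central: "kernel D G \<pi> \<subseteq> centralizer D (carrier D)"
proof -
  let ?K = "kernel D G \<pi>"
  have K: "?K \<subseteq> carrier D" and eQ: "e ` Q \<subseteq> carrier D"
    by (auto simp: kernel_def dehn_gen_closed)
  have "e a \<otimes>\<^bsub>D\<^esub> z = z \<otimes>\<^bsub>D\<^esub> e a" if "z \<in> ?K" "a \<in> Q" for z a
    using that conj_op_dehn_gen[of z a]
    by (simp add: kernel_def conj_op_one dehn_quandle_closed dehn_gen_closed D.conj_op_eq_iff)
  then have "e ` Q \<subseteq> centralizer D ?K"
    using eQ by (auto simp: centralizer_def)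
  then have "generate D (e ` Q) \<subseteq> centralizer D ?K"
    using D.subgroup_centralizer[OF K] by (rule D.generate_subgroup_incl)
  then show ?thesis
    using D.subset_centralizer_commute[OF K] by (simp add: generate_dehn_group)
qed

text \<open>A conjugate \<open>g\<^sup>-\<^sup>1 x g\<close> of \<open>x \<in> \<Gamma>\<close> needs no generator of its own: if \<open>y\<close> is a lift of \<open>g\<close> to
  the subgroup generated by \<open>e ` \<Gamma>\<close>, then the corresponding generator is \<open>y\<^sup>-\<^sup>1 e\<^sub>x y\<close>.\<close>

lemma generate_dehn_group_generators:
  assumes "generate G \<Gamma> = carrier G"
  shows "generate D (e ` \<Gamma>) = carrier D"
proof -
  let ?S = "generate D (e ` \<Gamma>)"
  have e\<Gamma>: "e ` \<Gamma> \<subseteq> carrier D" using generators_subset_dehn_quandle dehn_gen_closed by auto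
  then have S: "subgroup ?S D" by (rule D.generate_is_subgroup)
  have "\<pi> ` e ` \<Gamma> = \<Gamma>"
    using generators_subset_dehn_quandle proj_dehn_gen by (force simp: image_image)
  then have surj: "\<pi> ` ?S = carrier G" using \<pi>.generate_img[OF e\<Gamma>] assms by simp
  have "e a \<in> ?S" if a: "a \<in> Q" for a
  proof -
    obtain x g where x: "x \<in> \<Gamma>" "g \<in> carrier G" "a = conj_op G x g"
      using a unfolding dehn_quandle_def conj_class_def by blast
    then obtain y where y: "y \<in> ?S" "\<pi> y = g" using surj by force
    then have "e a = conj_op D (e x) y"
      using x S generators_subset_dehn_quandle subgroup.mem_carrier
      by (force simp: conj_op_dehn_gen)
    then show ?thesis
      using x(1) y(1) S
      by (simp add: conj_op_def generate.incl subgroup.m_closed subgroup.m_inv_closed)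
  qed
  then have "generate D (e ` Q) \<subseteq> ?S" using S by (intro D.generate_subgroup_incl) auto
  then show ?thesis using D.generate_incl[OF e\<Gamma>] by (simp add: generate_dehn_group)
qed

lemma conj_class_fin_gen_classes_iff:
  assumes "a \<in> Q"
  shows "conj_class G a \<in> fin_gen_classes G \<Gamma> \<longleftrightarrow> ord a \<noteq> 0"
  using assms conj_class_gen_classes[OF generators_closed] dehn_quandle_closed[OF assms]
  by (auto simp: fin_gen_classes_def conj_class_def ord_conj_op)

lemma dehn_ab_fin_gen:
  assumes "a \<in> Q"
  shows "Ab\<^sub>f (e a) = (if ord a = 0 then 0 else frag_of (conj_class G a))"
  using assms by (simp add: dehn_ab_fin_def dehn_ab_gen[OF generators_closed] fin_proj_def
      conj_class_fin_gen_classes_iff)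

end

definition power_relations :: "'x set \<Rightarrow> ('x word \<times> 'x word) set \<Rightarrow> ('x \<times> nat) set" where
  "power_relations X R = {(a, k). a \<in> X \<and> 2 \<le> k \<and> power_rel a k \<in> R}"

locale Cbar_group = group G for G (structure) +
  fixes X :: "'x set" and \<gamma> :: "'x \<Rightarrow> 'a" and R :: "('x word \<times> 'x word) set"
  assumes Cbar_presentation: "Cbar_presentation G X \<gamma> R"
begin

lemma presentation: "is_presentation G X \<gamma> R"
  using Cbar_presentation by (simp add: Cbar_presentation_def)

lemma \<gamma>_closed: "a \<in> X \<Longrightarrow> \<gamma> a \<in> carrier G"
  using presentation by (auto simp: is_presentation_def)

lemma word_eval_relation: "r \<in> R \<Longrightarrow> word_eval G \<gamma> (fst r) = word_eval G \<gamma> (snd r)"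
  using presentation by (auto simp: is_presentation_def)

sublocale dehn G "\<gamma> ` X"
  by unfold_locales (auto simp: \<gamma>_closed)

lemma \<gamma>_dehn_quandle: "a \<in> X \<Longrightarrow> \<gamma> a \<in> Q"
  using generators_subset_dehn_quandle by auto

lemma relation_cases:
  assumes "r \<in> R"
  obtains (conj) a b c where "a \<in> X" "b \<in> X" "c \<in> X" "r = conj_rel a b c"
  | (power) a k where "(a, k) \<in> power_relations X R" "r = power_rel a k"
  using assms Cbar_presentation by (fastforce simp: Cbar_presentation_def power_relations_def)

lemma inj_on_conj_class_power_relations: "inj_on (\<lambda>(a, k). conj_class G (\<gamma> a)) (power_relations X R)"
proof (rule inj_onI, clarify)
  fix a k a' k'
  assume pow: "(a, k) \<in> power_relations X R" "(a', k') \<in> power_relations X R"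
    and same_class: "conj_class G (\<gamma> a) = conj_class G (\<gamma> a')"
  then have closed: "\<gamma> a \<in> carrier G" "\<gamma> a' \<in> carrier G"
    by (auto simp: power_relations_def \<gamma>_closed)
  then have "conj_class G (\<gamma> a) \<in> conj_classes G" by (simp add: conj_classes_def)
  then have at_most_one: "\<exists>\<^sub>\<le>\<^sub>1r. r \<in> R \<and>
      (\<exists>b\<in>X. \<exists>n\<ge>2. r = power_rel b n \<and> \<gamma> b \<in> conj_class G (\<gamma> a))"
    using Cbar_presentation by (simp add: Cbar_presentation_def)
  have "\<gamma> a \<in> conj_class G (\<gamma> a)" "\<gamma> a' \<in> conj_class G (\<gamma> a)"
    using closed conj_class_self same_class by auto
  then have "power_rel a k = power_rel a' k'"
    using pow by (intro Uniq_D[OF at_most_one]) (auto simp: power_relations_def)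
  then show "a = a' \<and> k = k'"
    using pow by (auto simp: power_rel_def power_relations_def replicate_eq_replicate)
qed

definition dehn_power :: "'x \<times> nat \<Rightarrow> 'a word set" where
  "dehn_power = (\<lambda>(a, k). e (\<gamma> a) [^]\<^bsub>D\<^esub> k)"

lemma \<gamma>_pow_eq_one:
  assumes "(a, k) \<in> power_relations X R"
  shows "\<gamma> a [^] k = \<one>"
  using assms word_eval_relation[of "power_rel a k"] \<gamma>_closed
  by (auto simp: power_relations_def word_eval_power_rel)

lemma dehn_power_in_kernel: "dehn_power ` power_relations X R \<subseteq> kernel D G \<pi>"
proof clarify
  fix a k assume pow: "(a, k) \<in> power_relations X R"
  then have "\<gamma> a \<in> Q" by (auto simp: power_relations_def \<gamma>_dehn_quandle)
  then show "dehn_power (a, k) \<in> kernel D G \<pi>"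
    using \<gamma>_pow_eq_one[OF pow]
    by (simp add: dehn_power_def kernel_def dehn_gen_closed \<pi>.hom_nat_pow proj_dehn_gen)
qed

lemma dehn_power_central: "dehn_power ` power_relations X R \<subseteq> centralizer D (carrier D)"
  using dehn_power_in_kernel kernel_dehn_proj_central by (rule order_trans)

lemma dehn_power_closed: "dehn_power ` power_relations X R \<subseteq> carrier D"
  using dehn_power_in_kernel by (auto simp: kernel_def)

abbreviation T :: "'a word set set" where "T \<equiv> generate D (dehn_power ` power_relations X R)"

lemma normal_generate_dehn_power: "T \<lhd> D"
proof (rule D.central_subgroup_normal)
  show "subgroup T D" using dehn_power_closed by (rule D.generate_is_subgroup)
  show "T \<subseteq> centralizer D (carrier D)"
    using dehn_power_central D.subgroup_centralizer by (rule D.generate_subgroup_incl) simp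
qed

lemma r_coset_word_eval_relation:
  assumes "r \<in> R"
  shows "T #>\<^bsub>D\<^esub> word_eval D (e \<circ> \<gamma>) (fst r) = T #>\<^bsub>D\<^esub> word_eval D (e \<circ> \<gamma>) (snd r)"
  using assms
proof (cases rule: relation_cases)
  case (conj a b c)
  have "conj_op G (\<gamma> a) (\<gamma> b) = \<gamma> c"
    using word_eval_relation[OF assms] conj \<gamma>_closed by (simp add: word_eval_conj_rel)
  then have "conj_op D (e (\<gamma> a)) (e (\<gamma> b)) = e (\<gamma> c)"
    using conj by (simp add: conj_op_dehn_gen_gen \<gamma>_dehn_quandle)
  then show ?thesis
    using conj by (simp add: D.word_eval_conj_rel \<gamma>_dehn_quandle dehn_gen_closed)
next
  case (power a k)
  have "e (\<gamma> a) \<in> carrier D"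
    using power by (auto simp: power_relations_def \<gamma>_dehn_quandle dehn_gen_closed)
  then have "word_eval D (e \<circ> \<gamma>) (fst r) = dehn_power (a, k)" "word_eval D (e \<circ> \<gamma>) (snd r) = \<one>\<^bsub>D\<^esub>"
    using power by (simp_all add: D.word_eval_power_rel dehn_power_def)
  moreover have "dehn_power (a, k) \<in> T" using power by (intro generate.incl imageI)
  ultimately show ?thesis
    using normal_imp_subgroup[OF normal_generate_dehn_power] D.coset_join2 subgroup.mem_carrier
      subgroup.one_closed by metis
qed

lemma kernel_dehn_proj_subset_generate: "kernel D G \<pi> \<subseteq> T"
proof (rule \<pi>.kernel_subset_of_presentation[OF presentation])
  show "generate D ((e \<circ> \<gamma>) ` X) = carrier D"
    using generate_dehn_group_generators generate_presentation[OF presentation]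
    by (simp add: image_comp)
qed (auto simp: \<gamma>_dehn_quandle dehn_gen_closed proj_dehn_gen
    normal_generate_dehn_power dest: r_coset_word_eval_relation)

lemma dehn_ab_fin_power:
  assumes "(a, k) \<in> power_relations X R"
  shows "Ab\<^sub>f (dehn_power (a, k)) = frag_cmul (int k) (frag_of (conj_class G (\<gamma> a)))"
proof -
  have a: "\<gamma> a \<in> Q" "0 < k" using assms by (auto simp: power_relations_def \<gamma>_dehn_quandle)
  then have "ord (\<gamma> a) \<noteq> 0"
    using \<gamma>_pow_eq_one[OF assms] pow_eq_id[of "\<gamma> a" k] dehn_quandle_closed by auto
  then show ?thesis
    using a by (simp add: dehn_power_def Ab\<^sub>f.hom_nat_pow dehn_gen_closed dehn_ab_fin_gen)
qed

lemma inj_on_dehn_ab_fin_generate: "inj_on Ab\<^sub>f T"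
proof (rule D.inj_on_generate_hom_free_Abelian_group)
  show "dehn_power ` power_relations X R \<subseteq> centralizer D (dehn_power ` power_relations X R)"
    using dehn_power_central centralizer_anti_mono[OF dehn_power_closed] by (rule order_trans)
  show "Ab\<^sub>f \<in> hom D (free_Abelian_group (fin_gen_classes G (\<gamma> ` X)))" by (rule Ab\<^sub>f.homh)
  show "inj_on (\<lambda>(a, k). conj_class G (\<gamma> a)) (power_relations X R)"
    by (rule inj_on_conj_class_power_relations)
  fix p assume "p \<in> power_relations X R"
  then show "Ab\<^sub>f (dehn_power p)
      = frag_cmul (int (snd p)) (frag_of (case p of (a, k) \<Rightarrow> conj_class G (\<gamma> a)))"
    and "int (snd p) \<noteq> 0"
    by (auto simp: dehn_ab_fin_power power_relations_def split: prod.split)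
qed

end

theorem theorem4p3:
  fixes G :: "('g, 'm) monoid_scheme"
    and X :: "'x set" and \<gamma> :: "'x \<Rightarrow> 'g" and R :: "('x word \<times> 'x word) set"
  assumes "group G" and "Cbar_presentation G X \<gamma> R"
  shows "(\<lambda>z. (dehn_proj G z, dehn_ab_fin G (\<gamma> ` X) z))
           \<in> hom (dehn_group G (\<gamma> ` X)) (G \<times>\<times> free_Abelian_group (fin_gen_classes G (\<gamma> ` X)))
         \<and> inj_on (\<lambda>z. (dehn_proj G z, dehn_ab_fin G (\<gamma> ` X) z)) (carrier (dehn_group G (\<gamma> ` X)))"
proof
  interpret Cbar_group G X \<gamma> R
    using assms by (intro Cbar_group.intro Cbar_group_axioms.intro)
  show "(\<lambda>z. (\<pi> z, Ab\<^sub>f z)) \<in> hom D (G \<times>\<times> free_Abelian_group (fin_gen_classes G (\<gamma> ` X)))"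
    using \<pi>.homh Ab\<^sub>f.homh by (simp add: hom_paired)
  have "inj_on Ab\<^sub>f (kernel D G \<pi>)"
    using inj_on_dehn_ab_fin_generate kernel_dehn_proj_subset_generate by (rule inj_on_subset)
  then show "inj_on (\<lambda>z. (\<pi> z, Ab\<^sub>f z)) (carrier D)"
    by (rule \<pi>.inj_on_Pair_hom[OF Ab\<^sub>f.group_hom_axioms])
qed

end
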